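(* For every integer $n\ge 1$, conjugation of partitions $\lambda\mapsto\lambda'$ defines an involutive automorphism of the partition graph $G_n$; that is, it is a bijection of the vertex set of $G_n$ preserving adjacency, and $(\lambda')'=\lambda$ for all $\lambda\vdash n$.
   Context: A partition of a positive integer $n$ is a finite weakly decreasing sequence $\lambda=(\lambda_1,\dots,\lambda_\ell)$ of positive integers with sum $n$ (written $\lambda\vdash n$); partitions are identified with their Ferrers diagrams. The conjugate $\lambda'$ of $\lambda$ is the partition obtained by interchanging rows and columns of the Ferrers diagram. The partition graph $G_n$ is the simple graph whose vertices are the partitions of $n$; two distinct partitions are adjacent if and only if one is obtained from the other by an elementary transfer of one cell of the Ferrers diagram (moving a cell from a removable corner to an addable corner, followed by reordering, with the result different from the original partition). Equivalently: one decreases one part by $1$ and increases another part by $1$, where the increased part may also be a new part of length $0$ (thus creating a new part $1$), deletes any part that became $0$, sorts into weakly decreasing order, and requires that the resulting partition differ from the original. *)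

theory Defs
  imports "Graph_Theory.Pair_Digraph"
begin

definition partition_of :: "nat \<Rightarrow> nat list \<Rightarrow> bool" where
  "partition_of n p \<longleftrightarrow> sorted_wrt (\<ge>) p \<and> (\<forall>x\<in>set p. x > 0) \<and> sum_list p = n"

text \<open>Cells are pairs (row, column), both counted from 0.\<close>

definition ferrers :: "nat list \<Rightarrow> (nat \<times> nat) set" where
  "ferrers p = {(i, j). i < length p \<and> j < p ! i}"

text \<open>The conjugate is the partition whose Ferrers diagram is the transposed one. Since a partition
  has no zero parts, it is determined by its diagram.\<close>

definition conjugate :: "nat list \<Rightarrow> nat list" where
  "conjugate p = (THE q. partition_of (sum_list p) q \<and> ferrers q = (ferrers p)\<inverse>)"

text \<open>Move a cell from row \<open>i\<close> to row \<open>j\<close>. The appended 0 is the row of length 0 in which a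
  new part 1 can be created, so \<open>j = length p\<close> is a legitimate target.\<close>

definition move_cell :: "nat list \<Rightarrow> nat \<Rightarrow> nat \<Rightarrow> nat list" where
  "move_cell p i j =
     (let r = p @ [0]
      in rev (sort (filter (\<lambda>x. x > 0) (r[i := r ! i - 1, j := r ! j + 1]))))"

definition elementary_transfer :: "nat list \<Rightarrow> nat list \<Rightarrow> bool" where
  "elementary_transfer p q \<longleftrightarrow>
     q \<noteq> p \<and> (\<exists>i j. i < length p \<and> j \<le> length p \<and> i \<noteq> j \<and> q = move_cell p i j)"

text \<open>As usual for \<open>pair_graph\<close>, an undirected edge is represented by its two arcs.\<close>

definition partition_graph :: "nat \<Rightarrow> nat list pair_pre_digraph" where
  "partition_graph n =
     \<lparr> pverts = {p. partition_of n p},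
       parcs = {(p, q). partition_of n p \<and> partition_of n q \<and>
                  (elementary_transfer p q \<or> elementary_transfer q p)} \<rparr>"

lemma finite_partitions: "finite {p. partition_of n p}"
proof (rule finite_subset)
  have len: "length p \<le> sum_list p" if "\<forall>x\<in>set p. x > 0" for p :: "nat list"
    using that by (induction p) auto
  show "{p. partition_of n p} \<subseteq> {p. set p \<subseteq> {..n} \<and> length p \<le> n}"
    using len member_le_sum_list by (fastforce simp: partition_of_def)
  show "finite {p. set p \<subseteq> {..n} \<and> length p \<le> n}"
    by (rule finite_lists_length_le) simp
qed

lemma pair_graph_partition_graph: "pair_graph (partition_graph n)"
proof
  show "finite (parcs (partition_graph n))"
    by (rule finite_subset[of _ "{p. partition_of n p} \<times> {p. partition_of n p}"])
       (auto simp: partition_graph_def finite_partitions)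
  show "symmetric (with_proj (partition_graph n))"
    by (auto simp: symmetric_def arcs_ends_def arc_to_ends_def partition_graph_def
        intro!: symI)
qed (auto simp: partition_graph_def finite_partitions elementary_transfer_def)

definition graph_automorphism :: "'a pair_pre_digraph \<Rightarrow> ('a \<Rightarrow> 'a) \<Rightarrow> bool" where
  "graph_automorphism G f \<longleftrightarrow>
     bij_betw f (pverts G) (pverts G) \<and>
     (\<forall>u\<in>pverts G. \<forall>v\<in>pverts G. (u, v) \<in> parcs G \<longleftrightarrow> (f u, f v) \<in> parcs G)"

end

theory Submission
  imports Defs
begin

text \<open>
  The length of column \<open>c\<close> of a diagram is the number of parts larger than \<open>c\<close>. It depends only on
  the multiset of the parts, and this makes the reordering after an elementary transfer invisible
  in column terms. If a part \<open>a\<close> becomes \<open>a - 1\<close>, then column \<open>a - 1\<close> loses one cell and no other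
  column changes; if a part \<open>b\<close>, possibly
  the empty row \<open>0\<close>, becomes \<open>b + 1\<close>, then column \<open>b\<close> gains one cell. As the columns of
  \<open>p\<close> are the parts of its conjugate, a transfer from a part \<open>a\<close> to a part \<open>b\<close> of \<open>p\<close> acts on the
  conjugate as a transfer from row \<open>a - 1\<close> to row \<open>b\<close> (\<open>conjugate_move_cell\<close>). The two rows differ,
  since for \<open>a - 1 = b\<close> the transfer merely exchanges the values \<open>a\<close> and \<open>b\<close> and so does nothing.

  Hence conjugation maps edges to edges. It is an involution because transposition of diagrams is
  one and a partition is determined by its diagram; so it is bijective, and its inverse, being
  conjugation again, also maps edges to edges.
\<close>

section \<open>Diagrams, columns and the conjugate\<close>

definition column_length :: "nat list \<Rightarrow> nat \<Rightarrow> nat" where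
  "column_length p c = length (filter (\<lambda>x. c < x) p)"

text \<open>For a weakly decreasing list, \<open>hd (p @ [0])\<close> is the number of nonempty columns, also when
  \<open>p\<close> is empty.\<close>

definition columns :: "nat list \<Rightarrow> nat list" where
  "columns p = map (column_length p) [0..<hd (p @ [0])]"

text \<open>In a weakly decreasing list, the parts larger than a given number form an initial segment.\<close>

lemma ferrers_iff_column_length:
  assumes "sorted_wrt (\<ge>) p"
  shows "(i, j) \<in> ferrers p \<longleftrightarrow> i < column_length p j"
  using assms
proof (induction p arbitrary: i)
  case Nil
  then show ?case by (simp add: ferrers_def column_length_def)
next
  case (Cons x p)
  show ?case
  proof (cases "j < x")
    case True
    have "(i, j) \<in> ferrers (x # p) \<longleftrightarrow> i = 0 \<or> (i - 1, j) \<in> ferrers p"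
      using True by (cases i) (auto simp: ferrers_def)
    with True Cons show ?thesis by (cases i) (auto simp: column_length_def)
  next
    case False
    with Cons.prems have "\<forall>y\<in>set p. \<not> j < y" by auto
    with False have "column_length (x # p) j = 0" by (simp add: column_length_def)
    moreover have "(i, j) \<notin> ferrers (x # p)"
      using False \<open>\<forall>y\<in>set p. \<not> j < y\<close> by (cases i) (auto simp: ferrers_def)
    ultimately show ?thesis by simp
  qed
qed

text \<open>Column 0 of the diagram recovers the number of parts, because all parts are positive.\<close>

lemma partition_eq_if_ferrers_eq:
  assumes "partition_of m p" "partition_of n q" "ferrers p = ferrers q"
  shows "p = q"
proof -
  have rows: "i < length r \<longleftrightarrow> (i, 0) \<in> ferrers r" if "partition_of k r" for k i r
    using that by (auto simp: partition_of_def ferrers_def)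
  have "i < length p \<longleftrightarrow> i < length q" for i
    using rows[OF assms(1)] rows[OF assms(2)] assms(3) by simp
  then have len: "length p = length q" by (metis linorder_cases less_irrefl)
  show ?thesis
  proof (rule nth_equalityI[OF len])
    fix i assume "i < length p"
    with len assms(3) have "j < p ! i \<longleftrightarrow> j < q ! i" for j
      unfolding ferrers_def set_eq_iff by fastforce
    then show "p ! i = q ! i" by (metis linorder_cases less_irrefl)
  qed
qed

lemma partition_eq_if_column_length_eq:
  assumes "partition_of m p" "partition_of n q" "\<And>c. column_length p c = column_length q c"
  shows "p = q"
proof (rule partition_eq_if_ferrers_eq[OF assms(1,2)])
  have "sorted_wrt (\<ge>) p" "sorted_wrt (\<ge>) q"
    using assms by (auto simp: partition_of_def)
  then show "ferrers p = ferrers q"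
    using assms(3) by (auto simp: ferrers_iff_column_length)
qed

lemma card_ferrers: "card (ferrers p) = sum_list p"
proof -
  have "ferrers p = Sigma {..<length p} (\<lambda>i. {..<p ! i})" by (auto simp: ferrers_def)
  then show ?thesis by (simp add: sum_list_sum_nth atLeast0LessThan)
qed

lemma column_length_pos_iff:
  assumes "sorted_wrt (\<ge>) p"
  shows "0 < column_length p c \<longleftrightarrow> c < hd (p @ [0])"
  using ferrers_iff_column_length[OF assms, of 0 c] by (cases p) (auto simp: ferrers_def)

lemma ferrers_columns:
  assumes "sorted_wrt (\<ge>) p"
  shows "ferrers (columns p) = (ferrers p)\<inverse>"
proof -
  have "(i, j) \<in> ferrers (columns p) \<longleftrightarrow> (j, i) \<in> ferrers p" for i j
  proof -
    have "(i, j) \<in> ferrers (columns p) \<longleftrightarrow> i < hd (p @ [0]) \<and> j < column_length p i"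
      by (auto simp: ferrers_def columns_def)
    also have "\<dots> \<longleftrightarrow> j < column_length p i"
      using column_length_pos_iff[OF assms, of i] by auto
    finally show ?thesis using ferrers_iff_column_length[OF assms] by simp
  qed
  then show ?thesis by auto
qed

lemma partition_of_columns:
  assumes "partition_of n p"
  shows "partition_of n (columns p)"
proof -
  have sorted: "sorted_wrt (\<ge>) p" using assms by (simp add: partition_of_def)
  have anti: "column_length p d \<le> column_length p c" if "c \<le> d" for c d
    using that unfolding column_length_def by (induction p) auto
  have "sorted_wrt (\<ge>) (columns p)"
    by (auto simp: columns_def sorted_wrt_iff_nth_less intro: anti)
  moreover have "\<forall>x\<in>set (columns p). 0 < x"
    using column_length_pos_iff[OF sorted] by (auto simp: columns_def)
  moreover have "sum_list (columns p) = sum_list p"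
    using ferrers_columns[OF sorted] card_ferrers by (metis card_inverse)
  ultimately show ?thesis using assms by (simp add: partition_of_def)
qed

lemma conjugate_eqI:
  assumes "partition_of n p" "partition_of n q" "ferrers q = (ferrers p)\<inverse>"
  shows "conjugate p = q"
proof -
  have "sum_list p = n" using assms(1) by (simp add: partition_of_def)
  then show ?thesis unfolding conjugate_def
    using assms partition_eq_if_ferrers_eq by (intro the_equality) auto
qed

lemma conjugate_eq_columns:
  assumes "partition_of n p"
  shows "conjugate p = columns p"
  using assms
  by (intro conjugate_eqI[OF assms partition_of_columns[OF assms]] ferrers_columns)
    (simp add: partition_of_def)

lemma partition_of_conjugate: "partition_of n p \<Longrightarrow> partition_of n (conjugate p)"
  by (simp add: conjugate_eq_columns partition_of_columns)

lemma conjugate_conjugate: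
  assumes "partition_of n p"
  shows "conjugate (conjugate p) = p"
proof (rule conjugate_eqI[OF partition_of_conjugate[OF assms] assms])
  have "ferrers (conjugate p) = (ferrers p)\<inverse>"
    using assms by (simp add: conjugate_eq_columns ferrers_columns partition_of_def)
  then show "ferrers p = (ferrers (conjugate p))\<inverse>" by simp
qed

section \<open>Elementary transfers in terms of columns\<close>

text \<open>Only the summand of the changed entry differs in the count. The old contributions stand on the
  left and the new ones on the right, which avoids truncated subtraction.\<close>

lemma column_length_list_update:
  assumes "i < length p"
  shows "column_length (p[i := v]) c + of_bool (c < p ! i) = column_length p c + of_bool (c < v)"
  using assms
proof (induction p arbitrary: i)
  case Nil
  then show ?case by simp
next
  case (Cons x p)
  show ?case
  proof (cases i)
    case 0
    then show ?thesis by (simp add: column_length_def)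
  next
    case (Suc k)
    with Cons show ?thesis by (fastforce simp: column_length_def)
  qed
qed

lemma column_length_cong_mset:
  assumes "mset p = mset q"
  shows "column_length p c = column_length q c"
  using assms unfolding column_length_def by (metis mset_filter size_mset)

lemma column_length_filter_pos: "column_length (filter (\<lambda>x. x > 0) p) c = column_length p c"
  by (auto simp: column_length_def intro!: arg_cong[where f = length] filter_cong)

lemma column_length_snoc_0: "column_length (p @ [0]) c = column_length p c"
  by (simp add: column_length_def)

text \<open>Neither the sorting nor the removal of zeros affects the counts, so only the two list updates
  matter. The thresholds \<open>c\<close> with \<open>c < a\<close> and \<open>c < a - 1\<close> differ in \<open>c = a - 1\<close> alone, and
  likewise those for \<open>b\<close> and \<open>b + 1\<close> in \<open>c = b\<close> alone.\<close>

lemma column_length_move_cell: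
  assumes "i < length p" "j \<le> length p" "i \<noteq> j" "0 < p ! i"
  shows "column_length (move_cell p i j) c + of_bool (c = p ! i - 1) =
    column_length p c + of_bool (c = (p @ [0]) ! j)"
proof -
  define r where "r = p @ [0]"
  define s where "s = r[i := r ! i - 1]"
  have ri: "r ! i = p ! i" and i: "i < length r" and j: "j < length s" "s ! j = r ! j"
    using assms by (auto simp: r_def s_def nth_append)
  have "column_length (move_cell p i j) c =
      column_length (filter (\<lambda>x. x > 0) (s[j := r ! j + 1])) c"
    by (rule column_length_cong_mset) (simp add: move_cell_def r_def s_def Let_def)
  then have "column_length (move_cell p i j) c = column_length (s[j := r ! j + 1]) c"
    by (simp only: column_length_filter_pos)
  moreover have "column_length (s[j := r ! j + 1]) c + of_bool (c < r ! j) =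
      column_length s c + of_bool (c < r ! j + 1)"
    using column_length_list_update[OF j(1)] j(2) by metis
  moreover have "column_length s c + of_bool (c < p ! i) =
      column_length p c + of_bool (c < p ! i - 1)"
    using column_length_list_update[OF i, of "r ! i - 1" c] column_length_snoc_0[of p c]
    by (simp add: s_def ri r_def[symmetric])
  moreover have "of_bool (c < r ! j + 1) = of_bool (c < r ! j) + (of_bool (c = r ! j) :: nat)"
    by auto
  moreover have "of_bool (c < p ! i) = of_bool (c < p ! i - 1) + (of_bool (c = p ! i - 1) :: nat)"
    using assms(4) by auto
  ultimately show ?thesis unfolding r_def[symmetric] by linarith
qed

text \<open>The list may include empty columns on the right, as happens when the last column loses its only
  cell.\<close>

lemma filter_pos_column_lengths:
  assumes "sorted_wrt (\<ge>) p" "hd (p @ [0]) \<le> m"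
  shows "filter (\<lambda>x. x > 0) (map (column_length p) [0..<m]) = columns p"
proof -
  have "[0..<m] = [0..<hd (p @ [0])] @ [hd (p @ [0])..<m]"
    using assms(2) by (metis le0 le_add_diff_inverse upt_add_eq_append)
  moreover have "filter (\<lambda>c. 0 < column_length p c) [0..<hd (p @ [0])] = [0..<hd (p @ [0])]"
    using column_length_pos_iff[OF assms(1)] by (auto simp: filter_id_conv)
  moreover have "filter (\<lambda>c. 0 < column_length p c) [hd (p @ [0])..<m] = []"
    using column_length_pos_iff[OF assms(1)] by (auto simp: filter_empty_conv)
  ultimately show ?thesis
    by (simp add: columns_def filter_map o_def)
qed

lemma rev_sort_partition:
  assumes "partition_of n p"
  shows "rev (sort p) = p"
proof -
  have "sorted (rev p)" using assms by (simp add: partition_of_def sorted_wrt_rev)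
  then have "sort p = rev p" by (intro properties_for_sort) simp_all
  then show ?thesis by simp
qed

text \<open>Updating the padded list of columns of \<open>p\<close> in the two changed places gives the columns of \<open>q\<close>,
  already in decreasing order. The target row is legitimate because every part of \<open>p\<close> is at most
  the largest one, which is the number of parts of the conjugate; a transfer to a part of maximal
  size creates a new part of the conjugate.\<close>

lemma conjugate_move_cell:
  assumes p: "partition_of n p" and q: "partition_of n q" and "q = move_cell p i j"
    and ij: "i < length p" "j \<le> length p" "i \<noteq> j"
    and ne: "p ! i - 1 \<noteq> (p @ [0]) ! j"
  shows "conjugate q = move_cell (conjugate p) (p ! i - 1) ((p @ [0]) ! j)"
    and "p ! i - 1 < length (conjugate p)" "(p @ [0]) ! j \<le> length (conjugate p)"
proof -
  define a where "a = p ! i - 1"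
  define b where "b = (p @ [0]) ! j"
  define k where "k = hd (p @ [0])"
  define r where "r = conjugate p @ [0]"
  have sp: "sorted_wrt (\<ge>) p" and sq: "sorted_wrt (\<ge>) q" and pos: "0 < p ! i"
    using p q ij by (auto simp: partition_of_def)
  have len: "length (conjugate p) = k"
    using conjugate_eq_columns[OF p] by (simp add: columns_def k_def)
  have le_k: "x \<le> k" if "x \<in> set p" for x
    using that sp by (cases p) (auto simp: k_def)
  have a: "a < k" using le_k[of "p ! i"] ij pos by (simp add: a_def)
  have b: "b \<le> k" using le_k[of "p ! j"] ij by (auto simp: b_def nth_append)
  have col: "column_length q c + of_bool (c = a) = column_length p c + of_bool (c = b)" for c
    using column_length_move_cell[OF ij pos] assms(3) by (simp add: a_def b_def)
  \<comment> \<open>The appended 0 is the length of the first empty column, so the bound includes \<open>k\<close>.\<close>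
  have r: "r ! c = column_length p c" if "c \<le> k" for c
  proof (cases "c < k")
    case True
    then show ?thesis
      using conjugate_eq_columns[OF p] len by (simp add: r_def nth_append columns_def k_def)
  next
    case False
    then show ?thesis
      using that len column_length_pos_iff[OF sp, of c] by (simp add: r_def nth_append k_def)
  qed
  have ab: "a \<noteq> b" using ne by (simp add: a_def b_def)
  have upd: "r[a := r ! a - 1, b := r ! b + 1] = map (column_length q) [0..<Suc k]"
  proof (rule nth_equalityI)
    show "length (r[a := r ! a - 1, b := r ! b + 1]) = length (map (column_length q) [0..<Suc k])"
      by (simp add: r_def len)
    fix c assume "c < length (r[a := r ! a - 1, b := r ! b + 1])"
    then have c: "c < Suc k" and "c < length r" by (simp_all add: r_def len)
    then have "r[a := r ! a - 1, b := r ! b + 1] ! c =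
        (if c = b then column_length p c + 1
         else if c = a then column_length p c - 1 else column_length p c)"
      using r[of c] by (auto simp: nth_list_update)
    also have "\<dots> = column_length q c"
      using col[of c] ab by (auto split: if_splits)
    also have "\<dots> = map (column_length q) [0..<Suc k] ! c"
      using c by (simp del: upt_Suc)
    finally show "r[a := r ! a - 1, b := r ! b + 1] ! c = map (column_length q) [0..<Suc k] ! c" .
  qed
  have "hd (q @ [0]) \<le> Suc k"
  proof (rule ccontr)
    assume "\<not> hd (q @ [0]) \<le> Suc k"
    then have "0 < column_length q (Suc k)" using column_length_pos_iff[OF sq] by simp
    with col[of "Suc k"] b have "0 < column_length p (Suc k)" by (auto split: if_splits)
    then show False using column_length_pos_iff[OF sp] by (simp add: k_def)
  qed
  then have "filter (\<lambda>x. x > 0) (r[a := r ! a - 1, b := r ! b + 1]) = conjugate q"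
    using filter_pos_column_lengths[OF sq] conjugate_eq_columns[OF q] upd by metis
  then have "move_cell (conjugate p) a b = conjugate q"
    using rev_sort_partition[OF partition_of_conjugate[OF q]]
    by (simp add: move_cell_def r_def[symmetric] Let_def)
  then show "conjugate q = move_cell (conjugate p) (p ! i - 1) ((p @ [0]) ! j)"
    by (simp add: a_def b_def)
  show "p ! i - 1 < length (conjugate p)" "(p @ [0]) ! j \<le> length (conjugate p)"
    using a b len by (simp_all add: a_def b_def)
qed

lemma elementary_transfer_conjugate:
  assumes p: "partition_of n p" and q: "partition_of n q" and "elementary_transfer p q"
  shows "elementary_transfer (conjugate p) (conjugate q)"
proof -
  obtain i j where ij: "i < length p" "j \<le> length p" "i \<noteq> j" and qm: "q = move_cell p i j"
    and "q \<noteq> p"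
    using assms(3) by (auto simp: elementary_transfer_def)
  have pos: "0 < p ! i" using p ij by (simp add: partition_of_def)
  have ne: "p ! i - 1 \<noteq> (p @ [0]) ! j"
  proof
    assume "p ! i - 1 = (p @ [0]) ! j"
    then have "column_length q c = column_length p c" for c
      using column_length_move_cell[OF ij pos, of c] qm by simp
    then show False using partition_eq_if_column_length_eq[OF q p] \<open>q \<noteq> p\<close> by simp
  qed
  have "conjugate q \<noteq> conjugate p"
    using conjugate_conjugate[OF p] conjugate_conjugate[OF q] \<open>q \<noteq> p\<close> by metis
  then show ?thesis
    using conjugate_move_cell[OF p q qm ij ne] ne unfolding elementary_transfer_def by blast
qed

section \<open>Conjugation as a graph automorphism\<close>

theorem proposition3p1:
  fixes n :: nat
  assumes "n \<ge> 1"
  shows "graph_automorphism (partition_graph n) conjugate \<and>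
    (\<forall>p\<in>pverts (partition_graph n). conjugate (conjugate p) = p)"
proof -
  have bij: "bij_betw conjugate {p. partition_of n p} {p. partition_of n p}"
    by (rule bij_betw_byWitness[where f' = conjugate])
      (auto simp: conjugate_conjugate partition_of_conjugate)
  have "elementary_transfer p q \<longleftrightarrow> elementary_transfer (conjugate p) (conjugate q)"
    if "partition_of n p" "partition_of n q" for p q
    using elementary_transfer_conjugate[OF that]
      elementary_transfer_conjugate[OF that[THEN partition_of_conjugate]]
      that[THEN conjugate_conjugate] by auto
  then have "(p, q) \<in> parcs (partition_graph n) \<longleftrightarrow>
      (conjugate p, conjugate q) \<in> parcs (partition_graph n)"
    if "partition_of n p" "partition_of n q" for p q
    using that by (simp add: partition_graph_def partition_of_conjugate)
  with bij show ?thesis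
    by (simp add: graph_automorphism_def partition_graph_def conjugate_conjugate)
qed

end
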